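(* Let $n\geq2$ and let $M$ be a finite monoid with group of units $G$. Then $$(2|M|-|G|)\binom n2\ \leq\ \mathrm{rank}(M\wr\mathrm{Sing}_n)\ \leq\ \begin{cases}|M|^2+1&\text{if }n=2,\\ |M|^2\binom n2&\text{if }n\geq3.\end{cases}$$
   Context: $\mathcal T_n$ is the monoid of all maps $\{1,\ldots,n\}\to\{1,\ldots,n\}$, written on the right and composed from left to right, and $\mathrm{Sing}_n$ is its subsemigroup of all non-bijective maps. The wreath product $M\wr\mathrm{Sing}_n$ is the set $M^n\times\mathrm{Sing}_n$ with product $$((a_1,\ldots,a_n),\alpha)((b_1,\ldots,b_n),\beta)=((a_1b_{1\alpha},\ldots,a_nb_{n\alpha}),\alpha\beta).$$ The rank of a semigroup $T$, $\mathrm{rank}(T)$, is the smallest cardinality of a set generating $T$ as a semigroup. *)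

theory Defs
  imports "HOL-Algebra.Group" "HOL-Library.FuncSet"
begin

definition full_transf :: "nat \<Rightarrow> (nat \<Rightarrow> nat) set" where
  "full_transf n = {1..n} \<rightarrow>\<^sub>E {1..n}"

(* Maps are written on the right and composed from left to right:
   i (\<alpha>\<beta>) = (i \<alpha>) \<beta>. *)
definition transf_mult :: "nat \<Rightarrow> (nat \<Rightarrow> nat) \<Rightarrow> (nat \<Rightarrow> nat) \<Rightarrow> (nat \<Rightarrow> nat)" where
  "transf_mult n \<alpha> \<beta> = (\<lambda>i\<in>{1..n}. \<beta> (\<alpha> i))"

definition Sing :: "nat \<Rightarrow> (nat \<Rightarrow> nat) set" where
  "Sing n = {\<alpha> \<in> full_transf n. \<not> bij_betw \<alpha> {1..n} {1..n}}"

(* An n-tuple (a_1,...,a_n) over M is an extensional function on {1..n}. *)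
definition wreath_carrier ::
  "('a, 'm) monoid_scheme \<Rightarrow> nat \<Rightarrow> (nat \<Rightarrow> nat) set \<Rightarrow> ((nat \<Rightarrow> 'a) \<times> (nat \<Rightarrow> nat)) set" where
  "wreath_carrier M n T = ({1..n} \<rightarrow>\<^sub>E carrier M) \<times> T"

fun wreath_mult ::
  "('a, 'm) monoid_scheme \<Rightarrow> nat \<Rightarrow> (nat \<Rightarrow> 'a) \<times> (nat \<Rightarrow> nat)
     \<Rightarrow> (nat \<Rightarrow> 'a) \<times> (nat \<Rightarrow> nat) \<Rightarrow> (nat \<Rightarrow> 'a) \<times> (nat \<Rightarrow> nat)" where
  "wreath_mult M n (a, \<alpha>) (b, \<beta>) =
     ((\<lambda>i\<in>{1..n}. a i \<otimes>\<^bsub>M\<^esub> b (\<alpha> i)), transf_mult n \<alpha> \<beta>)"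

inductive_set semigroup_span :: "('s \<Rightarrow> 's \<Rightarrow> 's) \<Rightarrow> 's set \<Rightarrow> 's set"
  for mul :: "'s \<Rightarrow> 's \<Rightarrow> 's" and A :: "'s set" where
  base: "x \<in> A \<Longrightarrow> x \<in> semigroup_span mul A"
| mult: "x \<in> semigroup_span mul A \<Longrightarrow> y \<in> semigroup_span mul A \<Longrightarrow>
           mul x y \<in> semigroup_span mul A"

(* Rank of the semigroup with underlying set S and product mul.  Only meaningful for
   finitely generated semigroups, in particular for all finite ones; otherwise the
   value is unspecified. *)
definition semigroup_rank :: "('s \<Rightarrow> 's \<Rightarrow> 's) \<Rightarrow> 's set \<Rightarrow> nat" where
  "semigroup_rank mul S =
     (LEAST k. \<exists>A. A \<subseteq> S \<and> finite A \<and> card A = k \<and> semigroup_span mul A = S)"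

end

theory Submission
  imports Defs
begin

text \<open>
  Lower bound: if a product has a kernel consisting of a single pair \<open>{i, j}\<close>, then its first
  factor \<open>(a, \<alpha>)\<close> has the same kernel, and the labels of the product at \<open>i\<close> and \<open>j\<close> are
  \<open>(a\<^sub>i m, a\<^sub>j m)\<close> for some \<open>m\<close>. So for every pair \<open>{i, j}\<close> the generators with this kernel must
  meet all the orbits of \<open>G\<close>, acting diagonally on the right, on those pairs of labels which have
  a unit component; the pairs \<open>(1, d)\<close> and \<open>(c, 1)\<close>, \<open>c\<close> a non-unit, represent
  \<open>2|M| - |G|\<close> orbits.

  Upper bound: orient the pairs as the tournament \<open>1 \<rightarrow> 2\<close>, \<open>2 \<rightarrow> k \<rightarrow> 1\<close> for \<open>k \<ge> 3\<close>, and
  \<open>i \<rightarrow> j\<close> for \<open>3 \<le> i < j\<close>. The idempotents moving a single point along an edge generate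
  \<open>Sing n\<close>, because reversals of edges are obtained from 3-cycles. Giving both end points of the
  edge arbitrary labels yields generators of the wreath product: once \<open>i\<close> has been
  collapsed to \<open>j\<close>, the position \<open>i\<close> is a hole which allows any other point to be moved
  there and back, collecting a label. For \<open>n = 2\<close> no orientation is strongly connected, and
  both constant maps are needed.
\<close>

section \<open>Point collapses, pairs of points and kernels\<close>

definition collapse :: "nat \<Rightarrow> nat \<Rightarrow> nat \<Rightarrow> (nat \<Rightarrow> nat)" where
  "collapse n i j = (\<lambda>k\<in>{1..n}. if k = i then j else k)"

definition ordered_pairs :: "nat \<Rightarrow> (nat \<times> nat) set" where
  "ordered_pairs n = {(i, j). 1 \<le> i \<and> i < j \<and> j \<le> n}"

text \<open>The kernel equivalence reduced to its off-diagonal pairs, each listed once in increasing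
  order. A singleton value thus means that the only nontrivial class has exactly two
  elements.\<close>

definition kernel_pairs :: "nat \<Rightarrow> (nat \<Rightarrow> nat) \<Rightarrow> (nat \<times> nat) set" where
  "kernel_pairs n \<alpha> = {(i, j) \<in> ordered_pairs n. \<alpha> i = \<alpha> j}"

lemma finite_ordered_pairs: "finite (ordered_pairs n)"
  by (rule finite_subset[of _ "{1..n} \<times> {1..n}"]) (auto simp: ordered_pairs_def)

text \<open>Listing the elements in increasing order matches two-element subsets with ordered
  pairs.\<close>

lemma card_ordered_pairs: "card (ordered_pairs n) = n choose 2"
proof -
  have "bij_betw (\<lambda>(i, j). {i, j}) (ordered_pairs n) {P. P \<subseteq> {1..n} \<and> card P = 2}"
  proof (rule bij_betwI')
    fix p q assume "p \<in> ordered_pairs n" "q \<in> ordered_pairs n"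
    then show "((case p of (i, j) \<Rightarrow> {i, j}) = (case q of (i, j) \<Rightarrow> {i, j})) = (p = q)"
      by (auto simp: ordered_pairs_def doubleton_eq_iff)
  next
    fix p assume "p \<in> ordered_pairs n"
    then show "(case p of (i, j) \<Rightarrow> {i, j}) \<in> {P. P \<subseteq> {1..n} \<and> card P = 2}"
      by (auto simp: ordered_pairs_def)
  next
    fix P assume P: "P \<in> {P. P \<subseteq> {1..n} \<and> card P = 2}"
    then obtain x y where xy: "P = {x, y}" "x \<noteq> y"
      by (auto simp: card_2_iff)
    with P have "(min x y, max x y) \<in> ordered_pairs n"
      by (auto simp: ordered_pairs_def min_def max_def)
    moreover have "P = {min x y, max x y}"
      using xy by (auto simp: min_def max_def)
    ultimately show "\<exists>p\<in>ordered_pairs n. P = (case p of (i, j) \<Rightarrow> {i, j})"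
      by (auto intro!: bexI[of _ "(min x y, max x y)"])
  qed
  then show ?thesis
    by (simp add: bij_betw_same_card n_subsets)
qed

lemma SingI:
  assumes "\<alpha> \<in> full_transf n" "i \<in> {1..n}" "j \<in> {1..n}" "i \<noteq> j" "\<alpha> i = \<alpha> j"
  shows "\<alpha> \<in> Sing n"
proof -
  have "\<not> inj_on \<alpha> {1..n}"
    using assms(2-) by (meson inj_onD)
  then show ?thesis
    using assms(1) by (simp add: Sing_def bij_betw_def)
qed

lemma Sing_full_transf: "\<alpha> \<in> Sing n \<Longrightarrow> \<alpha> \<in> full_transf n"
  by (simp add: Sing_def)

lemma full_transf_mem: "\<alpha> \<in> full_transf n \<Longrightarrow> i \<in> {1..n} \<Longrightarrow> \<alpha> i \<in> {1..n}"
  unfolding full_transf_def by (rule PiE_mem)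

lemma Sing_not_inj:
  assumes "\<alpha> \<in> Sing n"
  shows "\<not> inj_on \<alpha> {1..n}"
proof
  assume inj: "inj_on \<alpha> {1..n}"
  have "\<alpha> ` {1..n} \<subseteq> {1..n}"
    using full_transf_mem[OF Sing_full_transf[OF assms]] by blast
  then have "\<alpha> ` {1..n} = {1..n}"
    using inj endo_inj_surj by blast
  with inj assms show False
    by (simp add: Sing_def bij_betw_def)
qed

lemma SingE:
  assumes "\<alpha> \<in> Sing n"
  obtains i j where "i \<in> {1..n}" "j \<in> {1..n}" "i \<noteq> j" "\<alpha> i = \<alpha> j"
  using Sing_not_inj[OF assms] unfolding inj_on_def by blast

lemma kernel_pairs_Sing: "\<alpha> \<in> Sing n \<Longrightarrow> kernel_pairs n \<alpha> \<noteq> {}"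
proof -
  assume "\<alpha> \<in> Sing n"
  then obtain i j where "i \<in> {1..n}" "j \<in> {1..n}" "i \<noteq> j" "\<alpha> i = \<alpha> j"
    by (rule SingE)
  then have "(min i j, max i j) \<in> kernel_pairs n \<alpha>"
    by (auto simp: kernel_pairs_def ordered_pairs_def min_def max_def)
  then show ?thesis by blast
qed

lemma transf_mult_full_transf:
  "\<alpha> \<in> full_transf n \<Longrightarrow> \<beta> \<in> full_transf n \<Longrightarrow> transf_mult n \<alpha> \<beta> \<in> full_transf n"
  unfolding full_transf_def transf_mult_def by (auto simp: PiE_iff)

lemma transf_mult_Sing:
  assumes "\<alpha> \<in> Sing n" "\<beta> \<in> full_transf n"
  shows "transf_mult n \<alpha> \<beta> \<in> Sing n"
proof -
  obtain i j where "i \<in> {1..n}" "j \<in> {1..n}" "i \<noteq> j" "\<alpha> i = \<alpha> j"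
    using assms(1) by (rule SingE)
  then show ?thesis
    using transf_mult_full_transf[OF Sing_full_transf[OF assms(1)] assms(2)]
    by (intro SingI[of _ n i j]) (auto simp: transf_mult_def)
qed

lemma collapse_full_transf:
  "i \<in> {1..n} \<Longrightarrow> j \<in> {1..n} \<Longrightarrow> collapse n i j \<in> full_transf n"
  by (simp add: collapse_def full_transf_def PiE_iff)

lemma collapse_Sing:
  "i \<in> {1..n} \<Longrightarrow> j \<in> {1..n} \<Longrightarrow> i \<noteq> j \<Longrightarrow> collapse n i j \<in> Sing n"
  by (rule SingI[of _ n i j, OF collapse_full_transf]) (auto simp: collapse_def)

lemma collapse_apply:
  "i \<in> {1..n} \<Longrightarrow> collapse n i j i = j"
  "k \<in> {1..n} \<Longrightarrow> k \<noteq> i \<Longrightarrow> collapse n i j k = k"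
  by (auto simp: collapse_def)

lemma transf_mult_apply: "k \<in> {1..n} \<Longrightarrow> transf_mult n \<alpha> \<beta> k = \<beta> (\<alpha> k)"
  by (simp add: transf_mult_def)

lemma kernel_pairs_collapse:
  assumes "(i, j) \<in> ordered_pairs n"
  shows "kernel_pairs n (collapse n j i) = {(i, j)}"
proof (rule Set.set_eqI)
  fix p :: "nat \<times> nat"
  obtain k l where "p = (k, l)" by (rule prod.exhaust)
  with assms show "p \<in> kernel_pairs n (collapse n j i) \<longleftrightarrow> p \<in> {(i, j)}"
    by (cases "k = j"; cases "l = j")
      (auto simp: kernel_pairs_def ordered_pairs_def collapse_apply)
qed

lemma full_transf_eqI:
  assumes "\<alpha> \<in> full_transf n" "\<beta> \<in> full_transf n" "\<And>i. i \<in> {1..n} \<Longrightarrow> \<alpha> i = \<beta> i"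
  shows "\<alpha> = \<beta>"
  using assms unfolding full_transf_def by (rule PiE_ext)

section \<open>Generating the singular maps by collapses\<close>

text \<open>Abstract in \<open>T\<close>, to be instantiated later with the maps whose pairing with
  the trivial tuple lies in a span in the wreath product.\<close>

locale transf_closed =
  fixes n :: nat and T :: "(nat \<Rightarrow> nat) set"
  assumes closed: "\<alpha> \<in> T \<Longrightarrow> \<beta> \<in> T \<Longrightarrow> transf_mult n \<alpha> \<beta> \<in> T"
begin

text \<open>The edges of the 3-cycle from \<open>j\<close> to \<open>i\<close> to \<open>x\<close>
  to \<open>j\<close>, multiplied in the order used below, give a map that swaps \<open>j\<close>
  and \<open>x\<close> and sends \<open>i\<close> to \<open>x\<close>. Its square undoes the swap
  and sends \<open>i\<close> to \<open>j\<close>.\<close>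

lemma collapse_reverse:
  assumes "collapse n j i \<in> T" "collapse n i x \<in> T" "collapse n x j \<in> T"
    and "i \<in> {1..n}" "j \<in> {1..n}" "x \<in> {1..n}" "i \<noteq> j" "i \<noteq> x" "x \<noteq> j"
  shows "collapse n i j \<in> T"
proof -
  let ?m = "transf_mult n"
  have "collapse n i j = ?m (?m (?m (collapse n j i) (collapse n x j)) (collapse n i x))
      (?m (?m (collapse n j i) (collapse n x j)) (collapse n i x))" (is "_ = ?r")
  proof (rule full_transf_eqI)
    show "collapse n i j \<in> full_transf n" "?r \<in> full_transf n"
      using assms(4-6) by (simp_all add: transf_mult_full_transf collapse_full_transf del: atLeastAtMost_iff)
    fix k assume "k \<in> {1..n}"
    then show "collapse n i j k = ?r k"
      using assms(4-9) by (cases "k = i"; cases "k = j"; cases "k = x")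
        (simp_all add: transf_mult_apply collapse_apply del: atLeastAtMost_iff)
  qed
  then show ?thesis
    using assms closed by metis
qed

text \<open>Induction on the number of moved points. Two points with equal image are not both fixed,
  so a collapse of a moved one, \<open>h\<close>, onto the other splits off. The remaining factor is
  singular with fewer moved points, or the identity, or a nontrivial permutation; only the last case
  needs a further rearrangement.\<close>

lemma Sing_subset_of_collapse:
  assumes coll: "\<And>i j. i \<in> {1..n} \<Longrightarrow> j \<in> {1..n} \<Longrightarrow> i \<noteq> j \<Longrightarrow> collapse n i j \<in> T"
  shows "Sing n \<subseteq> T"
proof
  fix \<gamma> assume "\<gamma> \<in> Sing n"
  then show "\<gamma> \<in> T"
  proof (induction "card {k \<in> {1..n}. \<gamma> k \<noteq> k}" arbitrary: \<gamma> rule: less_induct)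
    case less
    have full: "\<gamma> \<in> full_transf n"
      using less.prems by (rule Sing_full_transf)
    note mem = full_transf_mem[OF full]
    obtain i0 j0 where "i0 \<in> {1..n}" "j0 \<in> {1..n}" "i0 \<noteq> j0" "\<gamma> i0 = \<gamma> j0"
      using less.prems by (rule SingE)
    moreover from this have "\<gamma> i0 \<noteq> i0 \<or> \<gamma> j0 \<noteq> j0"
      by auto
    ultimately obtain h j where h: "h \<in> {1..n}" and j: "j \<in> {1..n}"
      and hj: "h \<noteq> j" "\<gamma> h = \<gamma> j" and moved: "\<gamma> h \<noteq> h"
      by metis
    \<comment> \<open>After the collapse no point sits at \<open>h\<close>, so the value there is
      free; choosing \<open>h\<close> creates a new fixed point.\<close>
    define \<pi> where "\<pi> = \<gamma>(h := h)"
    have \<pi>_full: "\<pi> \<in> full_transf n"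
      using full h unfolding \<pi>_def full_transf_def by (auto simp: PiE_def extensional_def)
    have \<gamma>_eq: "\<gamma> = transf_mult n (collapse n h j) \<pi>"
    proof (rule full_transf_eqI[OF full])
      show "transf_mult n (collapse n h j) \<pi> \<in> full_transf n"
        using \<pi>_full h j by (intro transf_mult_full_transf collapse_full_transf)
      show "\<gamma> x = transf_mult n (collapse n h j) \<pi> x" if "x \<in> {1..n}" for x
        using that h hj by (cases "x = h")
          (simp_all add: transf_mult_apply collapse_apply \<pi>_def del: atLeastAtMost_iff)
    qed
    show ?case
    proof (cases "\<pi> \<in> Sing n")
      case True
      have "{k \<in> {1..n}. \<pi> k \<noteq> k} \<subset> {k \<in> {1..n}. \<gamma> k \<noteq> k}"
        using h moved by (auto simp: \<pi>_def)
      then have "\<pi> \<in> T"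
        by (intro less.hyps True psubset_card_mono) auto
      with \<gamma>_eq coll[OF h j hj(1)] closed show ?thesis by metis
    next
      case False
      then have inj: "inj_on \<pi> {1..n}"
        using \<pi>_full by (simp add: Sing_def bij_betw_def)
      have \<pi>h: "\<pi> h = h" by (simp add: \<pi>_def)
      show ?thesis
      proof (cases "\<exists>k\<in>{1..n}. \<pi> k \<noteq> k")
        case False
        have "\<gamma> = collapse n h j"
        proof (intro full_transf_eqI[OF full] collapse_full_transf h j)
          fix x assume x: "x \<in> {1..n}"
          have fixed: "\<gamma> y = y" if "y \<in> {1..n}" "y \<noteq> h" for y
            using False that by (metis \<pi>_def fun_upd_other)
          show "\<gamma> x = collapse n h j x"
            using x h hj fixed[OF x] fixed[OF j] by (cases "x = h")
              (simp_all add: collapse_apply del: atLeastAtMost_iff)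
        qed
        then show ?thesis using coll h j hj by simp
      next
        case True
        then obtain k l where k: "k \<in> {1..n}" and l: "\<pi> k = l" and lk: "l \<noteq> k" by blast
        have kh: "k \<noteq> h" using \<pi>h l lk by metis
        have \<gamma>k: "\<gamma> k = l" using l kh by (simp add: \<pi>_def)
        have ln: "l \<in> {1..n}" using mem[OF k] \<gamma>k by simp
        have lh: "l \<noteq> h" using inj \<pi>h l k h kh by (metis inj_onD)
        have "\<pi> l \<noteq> l" using inj l k ln lk by (metis inj_onD)
        then have \<gamma>l: "\<gamma> l \<noteq> l" using lh by (simp add: \<pi>_def)
        \<comment> \<open>Since \<open>h\<close> is a hole after the collapse, \<open>k\<close> and \<open>l\<close> can be swapped through it, so that
          \<open>l\<close> becomes a fixed point of the remaining factor.\<close>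
        define \<delta> where "\<delta> = \<gamma>(h := l, l := l, k := \<gamma> l)"
        have \<delta>_full: "\<delta> \<in> full_transf n"
          using full h k ln mem[OF ln] unfolding \<delta>_def full_transf_def
          by (auto simp: PiE_def extensional_def)
        \<comment> \<open>The four collapses used below leave \<open>h\<close> empty, so the value
          of \<open>\<delta>\<close> at \<open>h\<close> is free; taking it equal to the value at
          \<open>l\<close> makes \<open>\<delta>\<close> singular.\<close>
        then have \<delta>_Sing: "\<delta> \<in> Sing n"
          using h ln lh kh lk by (intro SingI[of _ n h l]) (auto simp: \<delta>_def)
        \<comment> \<open>Both \<open>h\<close> and \<open>k\<close> were already moved by
          \<open>\<gamma>\<close>, so no new moved point arises, while \<open>l\<close> becomes
          fixed.\<close>
        have "{x \<in> {1..n}. \<delta> x \<noteq> x} \<subset> {x \<in> {1..n}. \<gamma> x \<noteq> x}"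
        proof (rule psubsetI)
          show "{x \<in> {1..n}. \<delta> x \<noteq> x} \<subseteq> {x \<in> {1..n}. \<gamma> x \<noteq> x}"
            using moved \<gamma>k lk by (auto simp: \<delta>_def split: if_splits)
          have "l \<in> {x \<in> {1..n}. \<gamma> x \<noteq> x}" "l \<notin> {x \<in> {1..n}. \<delta> x \<noteq> x}"
            using ln \<gamma>l lk by (simp_all add: \<delta>_def)
          then show "{x \<in> {1..n}. \<delta> x \<noteq> x} \<noteq> {x \<in> {1..n}. \<gamma> x \<noteq> x}"
            by metis
        qed
        then have \<delta>T: "\<delta> \<in> T"
          by (intro less.hyps \<delta>_Sing psubset_card_mono) auto
        let ?m = "transf_mult n"
        have "\<gamma> = ?m (collapse n h j) (?m (collapse n k h) (?m (collapse n l k)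
            (?m (collapse n h l) \<delta>)))" (is "_ = ?r")
        proof (rule full_transf_eqI[OF full])
          show "?r \<in> full_transf n"
            using h j k ln \<delta>_full
            by (simp add: transf_mult_full_transf collapse_full_transf del: atLeastAtMost_iff)
          have \<delta>: "\<delta> k = \<gamma> l" "\<delta> l = l" "\<delta> h = l" "\<And>x. x \<noteq> h \<Longrightarrow> x \<noteq> k \<Longrightarrow> x \<noteq> l \<Longrightarrow> \<delta> x = \<gamma> x"
            using kh lh lk by (auto simp: \<delta>_def)
          have other: "?r x = (if x = k then l else if x = l then \<gamma> l else \<gamma> x)"
            if "x \<in> {1..n}" "x \<noteq> h" for x
            using h j k ln kh lh lk hj(1) that \<delta>
            by (cases "x = k"; cases "x = l")
              (simp_all add: transf_mult_apply collapse_apply del: atLeastAtMost_iff)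
          \<comment> \<open>The first collapse merges \<open>h\<close> with \<open>j\<close>, so the
            value at \<open>h\<close> follows from that at \<open>j\<close>, whether or not
            \<open>j\<close> is \<open>k\<close> or \<open>l\<close>.\<close>
          have "?r h = ?r j"
            using h j hj(1) by (simp add: transf_mult_apply collapse_apply del: atLeastAtMost_iff)
          then show "\<gamma> x = ?r x" if "x \<in> {1..n}" for x
            using other[OF that] other[OF j] hj \<gamma>k by (cases "x = h") auto
        qed
        moreover have "collapse n h j \<in> T" "collapse n k h \<in> T" "collapse n l k \<in> T"
            "collapse n h l \<in> T"
          using coll h j hj k kh ln lh lk by auto
        ultimately show ?thesis using \<delta>T closed by metis
      qed
    qed
  qed
qed

end

section \<open>The tournament\<close>

text \<open>Meant for \<open>i < j\<close>: turning around just the pairs of \<open>1\<close> with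
  \<open>k \<ge> 3\<close> puts \<open>1\<close>, \<open>2\<close>, \<open>k\<close> on a directed
  3-cycle for every such \<open>k\<close>.\<close>

definition edge :: "nat \<Rightarrow> nat \<Rightarrow> nat \<times> nat" where
  "edge i j = (if i = 1 \<and> 3 \<le> j then (j, i) else (i, j))"

text \<open>The 3-cycles through \<open>1\<close> and \<open>2\<close> yield the reversals of all
  edges at these two points; with those, the remaining edges can be reversed too.\<close>

lemma (in transf_closed) Sing_subset_of_tournament:
  assumes n: "3 \<le> n"
    and edges: "\<And>i j u v. (i, j) \<in> ordered_pairs n \<Longrightarrow> edge i j = (u, v) \<Longrightarrow> collapse n u v \<in> T"
  shows "Sing n \<subseteq> T"
proof (rule Sing_subset_of_collapse)
  have e12: "collapse n 1 2 \<in> T"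
    using edges[of 1 2] n by (simp add: edge_def ordered_pairs_def)
  have e2: "collapse n 2 k \<in> T" if "3 \<le> k" "k \<le> n" for k
    using edges[of 2 k] that by (simp add: edge_def ordered_pairs_def)
  have e1: "collapse n k 1 \<in> T" if "3 \<le> k" "k \<le> n" for k
    using edges[of 1 k] that by (simp add: edge_def ordered_pairs_def)
  have e: "collapse n i j \<in> T" if "3 \<le> i" "i < j" "j \<le> n" for i j
    using edges[of i j] that by (simp add: edge_def ordered_pairs_def)
  have e21: "collapse n 2 1 \<in> T"
    using n by (intro collapse_reverse[of 1 2 3] e12 e1 e2) auto
  have e2': "collapse n k 2 \<in> T" if "3 \<le> k" "k \<le> n" for k
    using that n by (intro collapse_reverse[of 2 k 1] e12 e1 e2) auto
  have e1': "collapse n 1 k \<in> T" if "3 \<le> k" "k \<le> n" for k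
    using that n by (intro collapse_reverse[of k 1 2] e12 e1 e2) auto
  \<comment> \<open>The 3-cycle from \<open>i\<close> to \<open>j\<close> to \<open>1\<close> to
    \<open>i\<close> becomes available through the reversed edge from \<open>1\<close> to
    \<open>i\<close>.\<close>
  have e': "collapse n j i \<in> T" if "3 \<le> i" "i < j" "j \<le> n" for i j
    using that n by (intro collapse_reverse[of i j 1] e e1 e1') auto
  fix i j assume "i \<in> {1..n}" "j \<in> {1..n}" "i \<noteq> j"
  moreover from this have "i = 1 \<or> i = 2 \<or> 3 \<le> i" "j = 1 \<or> j = 2 \<or> 3 \<le> j" "i < j \<or> j < i"
    by auto
  ultimately show "collapse n i j \<in> T"
    using e12 e21 e1 e2 e1' e2' e e' by auto
qed

section \<open>Units of a finite monoid and orbit representatives\<close>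

text \<open>Left multiplication by \<open>z\<close> is injective because \<open>x\<close> undoes it,
  hence surjective by finiteness. So \<open>z\<close> has a right inverse, which must equal its left
  inverse \<open>x\<close>.\<close>

lemma (in monoid) finite_right_inverse:
  assumes fin: "finite (carrier G)" and x: "x \<in> carrier G" and z: "z \<in> carrier G"
    and xz: "x \<otimes> z = \<one>"
  shows "z \<otimes> x = \<one>"
proof -
  have "inj_on (\<lambda>w. z \<otimes> w) (carrier G)"
    by (rule inj_onI) (metis x z xz m_assoc l_one)
  moreover have "(\<lambda>w. z \<otimes> w) ` carrier G \<subseteq> carrier G"
    using z by auto
  ultimately have "(\<lambda>w. z \<otimes> w) ` carrier G = carrier G"
    using fin endo_inj_surj by blast
  then obtain w where w: "w \<in> carrier G" "z \<otimes> w = \<one>"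
    by (metis imageE one_closed)
  then have "w = x" by (metis x z xz m_assoc l_one r_one)
  with w show ?thesis by simp
qed

context monoid
begin

text \<open>A unit in the first component is scaled to \<open>\<one>\<close>; failing that, one in
  the second. Units are left out of the second family so that pairs of two units are not represented
  twice.\<close>

definition orbit_reps :: "('a \<times> 'a) set" where
  "orbit_reps = {\<one>} \<times> carrier G \<union> (carrier G - Units G) \<times> {\<one>}"

lemma card_orbit_reps:
  assumes "finite (carrier G)"
  shows "card orbit_reps = 2 * card (carrier G) - card (Units G)"
proof -
  have "Units G \<subseteq> carrier G" by (auto simp: Units_def)
  then have "card (carrier G - Units G) = card (carrier G) - card (Units G)"
    "card (Units G) \<le> card (carrier G)"
    using assms by (auto simp: card_Diff_subset finite_subset card_mono)
  moreover have "card orbit_reps = card (carrier G) + card (carrier G - Units G)"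
    unfolding orbit_reps_def using assms
    by (subst card_Un_disjoint) (auto simp: card_cartesian_product)
  ultimately show ?thesis by simp
qed

text \<open>If both products have \<open>\<one>\<close> in the same component, then
  \<open>m = m'\<close> because inverses are unique. Otherwise the first component of the
  representative from the second family would be a unit, which is excluded.\<close>

lemma orbit_reps_unique:
  assumes fin: "finite (carrier G)" and ab: "a \<in> carrier G" "b \<in> carrier G"
    and m: "m \<in> carrier G" and m': "m' \<in> carrier G"
    and r: "(a \<otimes> m, b \<otimes> m) \<in> orbit_reps" and r': "(a \<otimes> m', b \<otimes> m') \<in> orbit_reps"
  shows "(a \<otimes> m, b \<otimes> m) = (a \<otimes> m', b \<otimes> m')"
proof -
  note rinv = finite_right_inverse[OF fin]
  have cancel: "u = v" if "c \<in> carrier G" "u \<in> carrier G" "v \<in> carrier G"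
    "c \<otimes> u = \<one>" "c \<otimes> v = \<one>" for c u v
    using that rinv by (metis m_assoc l_one r_one)
  \<comment> \<open>By finiteness the one-sided inverses are two-sided, so \<open>c\<close> and
    \<open>v\<close> are both units.\<close>
  have mixed: "c \<otimes> v \<in> Units G" if "c \<in> carrier G" "d \<in> carrier G" "u \<in> carrier G"
    "v \<in> carrier G" "c \<otimes> u = \<one>" "d \<otimes> v = \<one>" for c d u v
    using that rinv by (intro Units_m_closed) (auto simp: Units_def)
  from r r' show ?thesis
    unfolding orbit_reps_def using cancel[OF ab(1) m m'] cancel[OF ab(2) m m']
      mixed[OF ab m m'] mixed[OF ab m' m] by auto
qed

end

section \<open>Labels in the wreath product and the lower bound\<close>

text \<open>Also used with \<open>i = j\<close> and \<open>u = v\<close>, for a tuple with a single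
  prescribed label.\<close>

definition labels :: "('a, 'm) monoid_scheme \<Rightarrow> nat \<Rightarrow> nat \<Rightarrow> 'a \<Rightarrow> nat \<Rightarrow> 'a \<Rightarrow> (nat \<Rightarrow> 'a)" where
  "labels M n i u j v = (\<lambda>k\<in>{1..n}. if k = i then u else if k = j then v else \<one>\<^bsub>M\<^esub>)"

context monoid
begin

lemma labels_PiE: "u \<in> carrier G \<Longrightarrow> v \<in> carrier G \<Longrightarrow> labels G n i u j v \<in> {1..n} \<rightarrow>\<^sub>E carrier G"
  unfolding labels_def by (auto intro!: restrict_PiE)

lemma wreath_mult_closed:
  assumes "x \<in> wreath_carrier G n (Sing n)" "y \<in> wreath_carrier G n (Sing n)"
  shows "wreath_mult G n x y \<in> wreath_carrier G n (Sing n)"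
proof -
  obtain a \<alpha> b \<beta> where xy: "x = (a, \<alpha>)" "y = (b, \<beta>)" by fastforce
  have "\<alpha> k \<in> {1..n}" if "k \<in> {1..n}" for k
    using assms(1) that xy full_transf_mem[OF Sing_full_transf]
    by (auto simp: wreath_carrier_def)
  then show ?thesis
    using assms xy transf_mult_Sing Sing_full_transf
    by (auto simp: wreath_carrier_def PiE_iff)
qed

lemma semigroup_span_subset:
  assumes "A \<subseteq> wreath_carrier G n (Sing n)"
  shows "semigroup_span (wreath_mult G n) A \<subseteq> wreath_carrier G n (Sing n)"
proof
  fix x assume "x \<in> semigroup_span (wreath_mult G n) A"
  then show "x \<in> wreath_carrier G n (Sing n)"
    using assms by induction (auto intro: wreath_mult_closed)
qed

text \<open>Induction over the span, following the left factor only: its kernel is forced to be the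
  same pair, and the right factor merely enlarges \<open>m\<close>.\<close>

lemma first_factor_labels:
  assumes A: "A \<subseteq> wreath_carrier G n (Sing n)"
    and x: "x \<in> semigroup_span (wreath_mult G n) A"
    and ker: "kernel_pairs n (snd x) = {(i, j)}"
  shows "\<exists>y\<in>A. kernel_pairs n (snd y) = {(i, j)} \<and>
    (\<exists>m\<in>carrier G. fst x i = fst y i \<otimes> m \<and> fst x j = fst y j \<otimes> m)"
  using x ker
proof induction
  case (base x)
  then have "(i, j) \<in> ordered_pairs n" "x \<in> wreath_carrier G n (Sing n)"
    using A by (auto simp: kernel_pairs_def)
  then have "fst x i \<in> carrier G" "fst x j \<in> carrier G"
    by (auto simp: ordered_pairs_def wreath_carrier_def PiE_iff)
  then have "fst x i = fst x i \<otimes> \<one>" "fst x j = fst x j \<otimes> \<one>"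
    by auto
  with base show ?case
    by blast
next
  case (mult y z)
  obtain a \<alpha> b \<beta> where yz: "y = (a, \<alpha>)" "z = (b, \<beta>)" by fastforce
  have W: "y \<in> wreath_carrier G n (Sing n)" "z \<in> wreath_carrier G n (Sing n)"
    using mult.hyps semigroup_span_subset[OF A] by blast+
  have "kernel_pairs n \<alpha> \<subseteq> kernel_pairs n (transf_mult n \<alpha> \<beta>)"
    by (auto simp: kernel_pairs_def ordered_pairs_def transf_mult_def)
  \<comment> \<open>Singularity of the left factor enters here: a nonempty subset of a singleton is
    all of it.\<close>
  moreover have "kernel_pairs n \<alpha> \<noteq> {}"
    using W yz by (intro kernel_pairs_Sing) (simp add: wreath_carrier_def)
  ultimately have ker: "kernel_pairs n \<alpha> = {(i, j)}"
    using mult.prems yz by auto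
  then obtain x m where x: "x \<in> A" "kernel_pairs n (snd x) = {(i, j)}" and m: "m \<in> carrier G"
    and eqs: "a i = fst x i \<otimes> m" "a j = fst x j \<otimes> m"
    using mult.IH(1) yz by auto
  have "(i, j) \<in> kernel_pairs n \<alpha>"
    using ker by simp
  then have ij: "i \<in> {1..n}" "j \<in> {1..n}" "\<alpha> i = \<alpha> j"
    by (simp_all add: kernel_pairs_def ordered_pairs_def)
  have "\<alpha> \<in> Sing n"
    using W(1) yz by (simp add: wreath_carrier_def)
  then have "\<alpha> j \<in> {1..n}"
    using ij(2) by (rule full_transf_mem[OF Sing_full_transf])
  moreover have "b \<in> {1..n} \<rightarrow>\<^sub>E carrier G"
    using W(2) yz by (simp add: wreath_carrier_def)
  ultimately have b: "b (\<alpha> j) \<in> carrier G"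
    by (rule PiE_mem[rotated])
  have "fst x \<in> {1..n} \<rightarrow>\<^sub>E carrier G"
    using subsetD[OF A x(1)] by (simp add: wreath_carrier_def mem_Times_iff)
  then have "fst x i \<in> carrier G" "fst x j \<in> carrier G"
    using ij by (meson PiE_mem)+
  \<comment> \<open>Both labels acquire the same right factor because \<open>\<alpha>\<close>
    identifies \<open>i\<close> and \<open>j\<close>.\<close>
  then have "fst (wreath_mult G n y z) i = fst x i \<otimes> (m \<otimes> b (\<alpha> j))"
    "fst (wreath_mult G n y z) j = fst x j \<otimes> (m \<otimes> b (\<alpha> j))"
    using ij eqs m b yz by (auto simp: m_assoc)
  moreover have "m \<otimes> b (\<alpha> j) \<in> carrier G"
    using m b by simp
  ultimately show ?case
    using x by blast
qed

text \<open>Choosing a generator for each representative and each pair is injective: the kernel of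
  the generator recovers the pair, and \<open>orbit_reps_unique\<close> the representative.\<close>

lemma generating_set_lower_bound:
  assumes fin: "finite (carrier G)"
    and A: "A \<subseteq> wreath_carrier G n (Sing n)" "finite A"
    and span: "semigroup_span (wreath_mult G n) A = wreath_carrier G n (Sing n)"
  shows "(2 * card (carrier G) - card (Units G)) * (n choose 2) \<le> card A"
proof -
  let ?Q = "orbit_reps \<times> ordered_pairs n"
  define P where "P q y \<longleftrightarrow> y \<in> A \<and> kernel_pairs n (snd y) = {snd q} \<and>
      (\<exists>m\<in>carrier G. fst q = (fst y (fst (snd q)) \<otimes> m, fst y (snd (snd q)) \<otimes> m))" for q y
  have "\<exists>y. P q y" if "q \<in> ?Q" for q
  proof -
    obtain u v i j where q: "q = ((u, v), (i, j))" by (metis surj_pair)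
    have uv: "u \<in> carrier G" "v \<in> carrier G" and ij: "(i, j) \<in> ordered_pairs n"
      using that q by (auto simp: orbit_reps_def)
    \<comment> \<open>A test element with kernel \<open>{(i, j)}\<close> and labels
      \<open>u\<close>, \<open>v\<close> there; some generator must account for it.\<close>
    let ?x = "(labels G n i u j v, collapse n j i)"
    have "?x \<in> wreath_carrier G n (Sing n)"
      using labels_PiE uv ij collapse_Sing[of j n i]
      by (auto simp: wreath_carrier_def ordered_pairs_def)
    then have "\<exists>y\<in>A. kernel_pairs n (snd y) = {(i, j)} \<and>
        (\<exists>m\<in>carrier G. fst ?x i = fst y i \<otimes> m \<and> fst ?x j = fst y j \<otimes> m)"
      using span kernel_pairs_collapse[OF ij] by (intro first_factor_labels[OF A(1)]) auto
    moreover have "fst ?x i = u" "fst ?x j = v"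
      using ij by (auto simp: labels_def ordered_pairs_def)
    ultimately show ?thesis
      unfolding P_def q by auto metis
  qed
  then obtain f where f: "\<And>q. q \<in> ?Q \<Longrightarrow> P q (f q)" by metis
  have "inj_on f ?Q"
  proof (rule inj_onI)
    fix q q' assume q: "q \<in> ?Q" and q': "q' \<in> ?Q" and eq: "f q = f q'"
    obtain a \<alpha> where y: "f q = (a, \<alpha>)" by fastforce
    have "{snd q} = {snd q'}"
      using f[OF q] f[OF q'] eq by (simp add: P_def)
    then obtain i j where ij: "snd q = (i, j)" "snd q' = (i, j)" by (metis singleton_inject surj_pair)
    have "(i, j) \<in> ordered_pairs n" using q ij by auto
    moreover have "(a, \<alpha>) \<in> wreath_carrier G n (Sing n)"
      using f[OF q] A y by (auto simp: P_def)
    ultimately have ab: "a i \<in> carrier G" "a j \<in> carrier G"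
      by (auto simp: wreath_carrier_def ordered_pairs_def)
    obtain m m' where m: "m \<in> carrier G" "m' \<in> carrier G"
      and e: "fst q = (a i \<otimes> m, a j \<otimes> m)" "fst q' = (a i \<otimes> m', a j \<otimes> m')"
      using f[OF q] f[OF q'] unfolding P_def eq[symmetric] y ij fst_conv snd_conv by blast
    have "fst q = fst q'"
      unfolding e using q q' e by (intro orbit_reps_unique[OF fin ab m]) auto
    with ij show "q = q'" by (simp add: prod_eq_iff)
  qed
  moreover have "f ` ?Q \<subseteq> A"
    using f by (auto simp: P_def)
  ultimately have "card ?Q \<le> card A"
    using A(2) by (rule card_inj_on_le)
  then show ?thesis
    using card_orbit_reps[OF fin] by (simp add: card_cartesian_product card_ordered_pairs)
qed

section \<open>Upper bound for at least three points\<close>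

text \<open>The label \<open>u\<close> belongs to the smaller point and \<open>v\<close> to the
  larger, whichever way the edge points.\<close>

definition tournament_gens :: "nat \<Rightarrow> ((nat \<Rightarrow> 'a) \<times> (nat \<Rightarrow> nat)) set" where
  "tournament_gens n = (\<lambda>((i, j), (u, v)). (labels G n i u j v, case_prod (collapse n) (edge i j)))
     ` (ordered_pairs n \<times> (carrier G \<times> carrier G))"

lemma tournament_gens_subset: "tournament_gens n \<subseteq> wreath_carrier G n (Sing n)"
proof -
  have "case_prod (collapse n) (edge i j) \<in> Sing n" if "(i, j) \<in> ordered_pairs n" for i j
    using that collapse_Sing[of i n j] collapse_Sing[of j n i]
    by (auto simp: ordered_pairs_def edge_def)
  then show ?thesis
    using labels_PiE unfolding tournament_gens_def wreath_carrier_def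
    by (auto simp del: PiE_iff atLeastAtMost_iff One_nat_def intro!: labels_PiE)
qed

lemma card_tournament_gens:
  assumes "finite (carrier G)"
  shows "finite (tournament_gens n)"
    and "card (tournament_gens n) \<le> (card (carrier G))\<^sup>2 * (n choose 2)"
proof -
  have fin: "finite (ordered_pairs n \<times> (carrier G \<times> carrier G))"
    using assms finite_ordered_pairs by auto
  then show "finite (tournament_gens n)"
    unfolding tournament_gens_def by simp
  have "card (tournament_gens n) \<le> card (ordered_pairs n \<times> (carrier G \<times> carrier G))"
    unfolding tournament_gens_def using fin by (rule card_image_le)
  then show "card (tournament_gens n) \<le> (card (carrier G))\<^sup>2 * (n choose 2)"
    by (simp add: card_cartesian_product card_ordered_pairs power2_eq_square mult.commute)
qed

text \<open>Trivial labels give all of \<open>Sing n\<close> over the trivial tuple. For a target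
  map, one starts with an edge inside its kernel, fills in the other labels one at a time through
  the hole, and finally multiplies by the target map with trivial labels.\<close>

lemma span_tournament_gens:
  assumes n: "3 \<le> n"
  shows "semigroup_span (wreath_mult G n) (tournament_gens n) = wreath_carrier G n (Sing n)"
proof
  let ?S = "semigroup_span (wreath_mult G n) (tournament_gens n)"
  show "?S \<subseteq> wreath_carrier G n (Sing n)"
    by (rule semigroup_span_subset[OF tournament_gens_subset])
  define one where "one = (\<lambda>k\<in>{1..n}. \<one>)"
  have gen: "(labels G n i u j v, collapse n s t) \<in> ?S"
    if "(i, j) \<in> ordered_pairs n" "edge i j = (s, t)" "u \<in> carrier G" "v \<in> carrier G"
    for i j u v s t
    using that unfolding tournament_gens_def
    by (intro semigroup_span.base image_eqI[of _ _ "((i, j), (u, v))"]) auto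
  have one_labels: "labels G n i \<one> j \<one> = one" for i j
    by (auto simp: labels_def one_def fun_eq_iff)
  interpret transf_closed n "{\<gamma> \<in> full_transf n. (one, \<gamma>) \<in> ?S}"
  proof
    fix \<alpha> \<beta> assume *: "\<alpha> \<in> {\<gamma> \<in> full_transf n. (one, \<gamma>) \<in> ?S}" "\<beta> \<in> {\<gamma> \<in> full_transf n. (one, \<gamma>) \<in> ?S}"
    then have "wreath_mult G n (one, \<alpha>) (one, \<beta>) \<in> ?S"
      by (blast intro: semigroup_span.mult)
    moreover have "wreath_mult G n (one, \<alpha>) (one, \<beta>) = (one, transf_mult n \<alpha> \<beta>)"
      using * full_transf_mem[of \<alpha> n] by (auto simp: one_def fun_eq_iff)
    ultimately show "transf_mult n \<alpha> \<beta> \<in> {\<gamma> \<in> full_transf n. (one, \<gamma>) \<in> ?S}"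
      using * transf_mult_full_transf by auto
  qed
  have "collapse n u v \<in> {\<gamma> \<in> full_transf n. (one, \<gamma>) \<in> ?S}"
    if "(i, j) \<in> ordered_pairs n" "edge i j = (u, v)" for i j u v
  proof -
    have "collapse n u v \<in> Sing n"
      using that by (intro collapse_Sing) (auto simp: edge_def ordered_pairs_def split: if_splits)
    then show ?thesis
      using gen[OF that one_closed one_closed] one_labels Sing_full_transf by auto
  qed
  then have one_S: "(one, \<gamma>) \<in> ?S" if "\<gamma> \<in> Sing n" for \<gamma>
    using Sing_subset_of_tournament[OF n] that by blast
  \<comment> \<open>Multiplies by \<open>u\<close> at \<open>k\<close> and disturbs at most the
    point \<open>s\<close>, which is going to be the hole.\<close>
  have relabel: "\<exists>\<delta>. (labels G n k u k u, \<delta>) \<in> ?S \<and> (\<forall>l\<in>{1..n}. l \<noteq> s \<longrightarrow> \<delta> l = l)"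
    if "k \<in> {1..n}" "s \<in> {1..n}" "k \<noteq> s" and u: "u \<in> carrier G" for k s u
  proof -
    define i j where "i = min k s" and "j = max k s"
    have ij: "(i, j) \<in> ordered_pairs n"
      using that by (auto simp: i_def j_def ordered_pairs_def)
    have lab: "labels G n k u k u = (if k = i then labels G n i u j \<one> else labels G n i \<one> j u)"
      using that by (auto simp: labels_def fun_eq_iff i_def j_def)
    obtain x y where xy: "edge i j = (x, y)" by fastforce
    have in_S: "(labels G n k u k u, collapse n x y) \<in> ?S"
      unfolding lab using gen[OF ij xy] u by auto
    have "(x = s \<and> y = k) \<or> (x = k \<and> y = s)"
      using xy that by (auto simp: edge_def i_def j_def min_def max_def split: if_splits)
    then show ?thesis
    proof
      assume "x = s \<and> y = k"
      with in_S show ?thesis by (auto simp: collapse_def)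
    next
      \<comment> \<open>The edge carries \<open>k\<close> into the hole, so a second collapse brings
        it back.\<close>
      assume *: "x = k \<and> y = s"
      have "wreath_mult G n (labels G n k u k u, collapse n k s) (one, collapse n s k) \<in> ?S"
        using in_S * that by (intro semigroup_span.mult one_S collapse_Sing) auto
      moreover have "wreath_mult G n (labels G n k u k u, collapse n k s) (one, collapse n s k)
          = (labels G n k u k u, transf_mult n (collapse n k s) (collapse n s k))"
        using that by (auto simp: fun_eq_iff labels_def one_def collapse_def)
      ultimately show ?thesis
        using that by (auto simp: transf_mult_def collapse_def)
    qed
  qed
  show "wreath_carrier G n (Sing n) \<subseteq> ?S"
  proof
    fix x assume "x \<in> wreath_carrier G n (Sing n)"
    then obtain c \<gamma> where x: "x = (c, \<gamma>)" and c: "c \<in> {1..n} \<rightarrow>\<^sub>E carrier G" and \<gamma>: "\<gamma> \<in> Sing n"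
      by (auto simp: wreath_carrier_def)
    have cc: "c k \<in> carrier G" if "k \<in> {1..n}" for k
      using c that by (rule PiE_mem)
    obtain i j where ij: "(i, j) \<in> ordered_pairs n" "\<gamma> i = \<gamma> j"
      using kernel_pairs_Sing[OF \<gamma>] by (auto simp: kernel_pairs_def)
    obtain s t where st: "edge i j = (s, t)" by fastforce
    have ijn: "i \<in> {1..n}" "j \<in> {1..n}" "i \<noteq> j"
      using ij by (auto simp: ordered_pairs_def)
    have cases: "(s = i \<and> t = j) \<or> (s = j \<and> t = i)"
      using st by (auto simp: edge_def split: if_splits)
    have stn: "s \<in> {1..n}" "t \<in> {1..n}" "s \<noteq> t"
      using cases ijn by metis+
    have p_mem: "collapse n s t l \<in> {1..n}" and p_hole: "collapse n s t l \<noteq> s"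
      if "l \<in> {1..n}" for l
      using that stn by (cases "l = s"; simp add: collapse_apply del: atLeastAtMost_iff)+
    have p_eq: "collapse n s t l = k \<longleftrightarrow> l = k" if "l \<in> {1..n}" "k \<noteq> i" "k \<noteq> j" for l k
      using that stn cases by (cases "l = s") (auto simp: collapse_apply)
    \<comment> \<open>\<open>K\<close> collects the positions outside the kernel pair whose labels
      are already correct; the generator itself supplies those at \<open>i\<close> and
      \<open>j\<close>.\<close>
    have partial: "((\<lambda>k\<in>{1..n}. if k \<in> K \<union> {i, j} then c k else \<one>), collapse n s t) \<in> ?S"
      if "finite K" "K \<subseteq> {1..n} - {i, j}" for K
      using that
    proof induction
      case empty
      have "(\<lambda>k\<in>{1..n}. if k \<in> {} \<union> {i, j} then c k else \<one>) = labels G n i (c i) j (c j)"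
        by (auto simp: labels_def fun_eq_iff)
      then show ?case
        using gen[OF ij(1) st] cc ijn by simp
    next
      case (insert k K)
      let ?c = "\<lambda>K. \<lambda>l\<in>{1..n}. if l \<in> K \<union> {i, j} then c l else \<one>"
      have k: "k \<in> {1..n}" "k \<noteq> i" "k \<noteq> j" "k \<notin> K" using insert by auto
      obtain \<delta> where \<delta>: "(labels G n k (c k) k (c k), \<delta>) \<in> ?S"
        and fixed: "\<forall>l\<in>{1..n}. l \<noteq> s \<longrightarrow> \<delta> l = l"
        using relabel[of k s "c k"] k ijn cases cc by auto
      have "wreath_mult G n (?c K, collapse n s t) (labels G n k (c k) k (c k), \<delta>) \<in> ?S"
        using insert.IH insert.prems by (intro semigroup_span.mult[OF _ \<delta>]) blast
      moreover have "wreath_mult G n (?c K, collapse n s t) (labels G n k (c k) k (c k), \<delta>)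
          = (?c (insert k K), collapse n s t)"
      proof -
        have "(\<lambda>l\<in>{1..n}. ?c K l \<otimes> labels G n k (c k) k (c k) (collapse n s t l)) = ?c (insert k K)"
        proof (rule restrict_ext)
          fix l assume l: "l \<in> {1..n}"
          have "labels G n k (c k) k (c k) (collapse n s t l) = (if l = k then c k else \<one>)"
            using p_mem[OF l] p_eq[OF l k(2,3)] by (simp add: labels_def)
          then show "?c K l \<otimes> labels G n k (c k) k (c k) (collapse n s t l)
              = (if l \<in> insert k K \<union> {i, j} then c l else \<one>)"
            using l k cc[OF l] by auto
        qed
        \<comment> \<open>The image of the collapse avoids \<open>s\<close>, the only point that
          \<open>\<delta>\<close> may move.\<close>
        moreover have "transf_mult n (collapse n s t) \<delta> = (\<lambda>l\<in>{1..n}. collapse n s t l)"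
          unfolding transf_mult_def using p_mem p_hole fixed by (intro restrict_ext) blast
        moreover have "(\<lambda>l\<in>{1..n}. collapse n s t l) = collapse n s t"
          by (simp add: collapse_def fun_eq_iff)
        ultimately show ?thesis by simp
      qed
      ultimately show ?case by (rule back_subst)
    qed
    have "(\<lambda>k\<in>{1..n}. if k \<in> ({1..n} - {i, j}) \<union> {i, j} then c k else \<one>) = (\<lambda>k\<in>{1..n}. c k)"
      by (rule restrict_ext) auto
    also have "\<dots> = c"
      using c by (rule PiE_restrict)
    finally have "(\<lambda>k\<in>{1..n}. if k \<in> ({1..n} - {i, j}) \<union> {i, j} then c k else \<one>) = c" .
    then have "(c, collapse n s t) \<in> ?S"
      using partial[of "{1..n} - {i, j}"] by (metis finite_Diff finite_atLeastAtMost order_refl)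
    then have "wreath_mult G n (c, collapse n s t) (one, \<gamma>) \<in> ?S"
      by (intro semigroup_span.mult one_S \<gamma>)
    moreover have "wreath_mult G n (c, collapse n s t) (one, \<gamma>) = x"
    proof -
      \<comment> \<open>The edge was chosen inside the kernel of \<open>\<gamma>\<close>.\<close>
      have "transf_mult n (collapse n s t) \<gamma> = \<gamma>"
      proof (rule full_transf_eqI)
        show "transf_mult n (collapse n s t) \<gamma> \<in> full_transf n"
          by (intro transf_mult_full_transf collapse_full_transf stn Sing_full_transf \<gamma>)
        have "\<gamma> s = \<gamma> t"
          using cases ij(2) by metis
        then show "transf_mult n (collapse n s t) \<gamma> k = \<gamma> k" if "k \<in> {1..n}" for k
          using that by (cases "k = s")
            (simp_all add: transf_mult_apply collapse_apply del: atLeastAtMost_iff)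
      qed (rule Sing_full_transf[OF \<gamma>])
      moreover have "(\<lambda>k\<in>{1..n}. c k \<otimes> one (collapse n s t k)) = (\<lambda>k\<in>{1..n}. c k)"
      proof (rule restrict_ext)
        fix k assume "k \<in> {1..n}"
        then show "c k \<otimes> one (collapse n s t k) = c k"
          using p_mem cc unfolding one_def by simp
      qed
      moreover have "(\<lambda>k\<in>{1..n}. c k) = c"
        using c by (rule PiE_restrict)
      ultimately show ?thesis by (simp add: x)
    qed
    ultimately show "x \<in> ?S" by simp
  qed
qed

section \<open>Upper bound for two points\<close>

text \<open>The two collapses are the constant maps. All labels are supplied over the constant map
  to \<open>1\<close>, and one element with trivial labels serves to change the constant.\<close>

definition gens_2 :: "((nat \<Rightarrow> 'a) \<times> (nat \<Rightarrow> nat)) set" where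
  "gens_2 = insert (labels G 2 1 \<one> 2 \<one>, collapse 2 1 2)
     ((\<lambda>(u, v). (labels G 2 1 u 2 v, collapse 2 2 1)) ` (carrier G \<times> carrier G))"

lemma gens_2_subset: "gens_2 \<subseteq> wreath_carrier G 2 (Sing 2)"
proof -
  have "collapse 2 1 2 \<in> Sing 2" "collapse 2 2 1 \<in> Sing 2"
    by (simp_all add: collapse_Sing)
  then show ?thesis
    unfolding gens_2_def wreath_carrier_def
    by (auto simp del: PiE_iff atLeastAtMost_iff One_nat_def intro!: labels_PiE)
qed

lemma card_gens_2:
  assumes "finite (carrier G)"
  shows "finite gens_2" and "card gens_2 \<le> (card (carrier G))\<^sup>2 + 1"
proof -
  let ?I = "(\<lambda>(u, v). (labels G 2 1 u 2 v, collapse 2 2 1)) ` (carrier G \<times> carrier G)"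
  have "finite (carrier G \<times> carrier G)"
    using assms by simp
  then have "card ?I \<le> card (carrier G \<times> carrier G)" and "finite ?I"
    by (auto intro: card_image_le)
  then show "finite gens_2" "card gens_2 \<le> (card (carrier G))\<^sup>2 + 1"
    using card_insert_le_m1 card_insert_if[of ?I]
    by (auto simp: gens_2_def card_cartesian_product power2_eq_square)
qed

lemma Sing_2: "Sing 2 \<subseteq> {collapse 2 1 2, collapse 2 2 1}"
proof
  fix \<gamma> assume \<gamma>: "\<gamma> \<in> Sing 2"
  obtain i j where "1 \<le> i" "i < j" "j \<le> 2" "\<gamma> i = \<gamma> j"
    using kernel_pairs_Sing[OF \<gamma>] by (auto simp: kernel_pairs_def ordered_pairs_def)
  moreover from this have "i = 1" "j = 2"
    by linarith+
  ultimately have eq: "\<gamma> 1 = \<gamma> 2" by simp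
  have const: "\<gamma> = collapse 2 i j" if "\<gamma> 1 = j" "{i, j} = {1, 2}" for i j
  proof (rule full_transf_eqI[OF Sing_full_transf[OF \<gamma>]])
    show "collapse 2 i j \<in> full_transf 2"
      using that by (intro collapse_full_transf) (auto simp: doubleton_eq_iff)
    fix k :: nat assume "k \<in> {1..2}"
    then have "k = 1 \<or> k = 2" by auto
    then show "\<gamma> k = collapse 2 i j k"
      using that eq by (auto simp: collapse_def doubleton_eq_iff)
  qed
  have "\<gamma> 1 = 1 \<or> \<gamma> 1 = 2"
    using full_transf_mem[OF Sing_full_transf[OF \<gamma>], of 1] by auto
  then show "\<gamma> \<in> {collapse 2 1 2, collapse 2 2 1}"
    using const[of 1 2] const[of 2 1] by auto
qed

text \<open>Right multiplication by the extra generator turns the constant map \<open>1\<close> into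
  the constant map \<open>2\<close> and keeps every label.\<close>

lemma span_gens_2: "semigroup_span (wreath_mult G 2) gens_2 = wreath_carrier G 2 (Sing 2)"
proof
  let ?S = "semigroup_span (wreath_mult G 2) gens_2"
  show "?S \<subseteq> wreath_carrier G 2 (Sing 2)"
    by (rule semigroup_span_subset[OF gens_2_subset])
  show "wreath_carrier G 2 (Sing 2) \<subseteq> ?S"
  proof
    fix x assume "x \<in> wreath_carrier G 2 (Sing 2)"
    then obtain c \<gamma> where x: "x = (c, \<gamma>)" and c: "c \<in> {1..2} \<rightarrow>\<^sub>E carrier G" and \<gamma>: "\<gamma> \<in> Sing 2"
      by (auto simp: wreath_carrier_def)
    have cc: "c 1 \<in> carrier G" "c 2 \<in> carrier G"
      using c by auto
    have c_eq: "c = labels G 2 1 (c 1) 2 (c 2)"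
    proof (rule PiE_ext[OF c labels_PiE[OF cc]])
      fix k :: nat assume "k \<in> {1..2}"
      then have "k = 1 \<or> k = 2" by auto
      then show "c k = labels G 2 1 (c 1) 2 (c 2) k"
        by (auto simp: labels_def)
    qed
    then have S1: "(c, collapse 2 2 1) \<in> ?S"
      using cc unfolding gens_2_def
      by (intro semigroup_span.base insertI2 image_eqI[of _ _ "(c 1, c 2)"]) auto
    have "wreath_mult G 2 (c, collapse 2 2 1) (labels G 2 1 \<one> 2 \<one>, collapse 2 1 2) \<in> ?S"
      by (intro semigroup_span.mult S1 semigroup_span.base) (simp add: gens_2_def)
    moreover have "wreath_mult G 2 (c, collapse 2 2 1) (labels G 2 1 \<one> 2 \<one>, collapse 2 1 2)
        = (c, collapse 2 1 2)"
    proof -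
      have "(\<lambda>k\<in>{1..2}. c k \<otimes> labels G 2 1 \<one> 2 \<one> (collapse 2 2 1 k)) = (\<lambda>k\<in>{1..2}. c k)"
      proof (rule restrict_ext)
        fix k :: nat assume "k \<in> {1..2}"
        then have "k = 1 \<or> k = 2" by auto
        then show "c k \<otimes> labels G 2 1 \<one> 2 \<one> (collapse 2 2 1 k) = c k"
          using cc by (auto simp: labels_def collapse_def)
      qed
      also have "\<dots> = c"
        using c by (rule PiE_restrict)
      finally have "(\<lambda>k\<in>{1..2}. c k \<otimes> labels G 2 1 \<one> 2 \<one> (collapse 2 2 1 k)) = c" .
      then show ?thesis
        by (auto simp: transf_mult_def collapse_def fun_eq_iff)
    qed
    ultimately show "x \<in> ?S"
      using S1 x \<gamma> Sing_2 by auto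
  qed
qed

end

theorem proposition4p11:
  fixes M :: "('a, 'm) monoid_scheme" and n :: nat
  assumes "monoid M" and "finite (carrier M)" and "n \<ge> 2"
  shows "(2 * card (carrier M) - card (Units M)) * (n choose 2)
           \<le> semigroup_rank (wreath_mult M n) (wreath_carrier M n (Sing n))
       \<and> semigroup_rank (wreath_mult M n) (wreath_carrier M n (Sing n))
           \<le> (if n = 2 then (card (carrier M))\<^sup>2 + 1
              else (card (carrier M))\<^sup>2 * (n choose 2))"
proof -
  interpret monoid M by fact
  let ?W = "wreath_carrier M n (Sing n)"
  let ?gen = "\<lambda>k A. A \<subseteq> ?W \<and> finite A \<and> card A = k \<and> semigroup_span (wreath_mult M n) A = ?W"
  let ?bound = "if n = 2 then (card (carrier M))\<^sup>2 + 1 else (card (carrier M))\<^sup>2 * (n choose 2)"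
  \<comment> \<open>This set gives the upper bound and also shows that the minimum is attained, so
    that the lower bound applies to a minimal generating set.\<close>
  obtain X where X: "?gen (card X) X" "card X \<le> ?bound"
  proof (cases "n = 2")
    case True
    then show ?thesis
      using that[of gens_2] gens_2_subset card_gens_2[OF assms(2)] span_gens_2 by simp
  next
    case False
    then show ?thesis
      using that[of "tournament_gens n"] tournament_gens_subset card_tournament_gens[OF assms(2)]
        span_tournament_gens assms(3) by simp
  qed
  have rank: "semigroup_rank (wreath_mult M n) ?W = (LEAST k. \<exists>A. ?gen k A)"
    by (simp add: semigroup_rank_def)
  have "(LEAST k. \<exists>A. ?gen k A) \<le> card X"
    using X(1) by (blast intro: Least_le)
  moreover have "\<exists>A. ?gen (LEAST k. \<exists>A. ?gen k A) A"
    using X(1) by (intro LeastI_ex[where P = "\<lambda>k. \<exists>A. ?gen k A"]) blast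
  then obtain A where "?gen (LEAST k. \<exists>A. ?gen k A) A" by blast
  then have "(2 * card (carrier M) - card (Units M)) * (n choose 2) \<le> (LEAST k. \<exists>A. ?gen k A)"
    using generating_set_lower_bound[OF assms(2), of A n] by metis
  ultimately show ?thesis
    using X(2) unfolding rank by linarith
qed

end
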